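(* Let $\mathbf p=(p,X,Y)$ be a bivincular pattern of rank $r$ (i.e. $p\in\mathfrak S_r$) such that $r\in Y$. A permutation $\pi$ avoids the pattern $\mathbf p$ if and only if the permutation $\pi\oplus1$ avoids the pattern $\mathbf p\oplus1$.
   Context: A bivincular pattern is a triple $(p,X,Y)$ with $p\in\mathfrak S_r$ and $X,Y\subseteq\{0,1,\dots,r\}$. An occurrence of $(p,X,Y)$ in $\pi=\pi_1\cdots\pi_n\in\mathfrak S_n$ is a subsequence $\pi_{i_1}\cdots\pi_{i_r}$ ($i_1<\cdots<i_r$) whose letters are in the same relative order as the letters of $p$, such that $i_{x+1}=i_x+1$ for all $x\in X$, and $j_{y+1}=j_y+1$ for all $y\in Y$, where $\{\pi_{i_1},\dots,\pi_{i_r}\}=\{j_1<\cdots<j_r\}$ and by convention $i_0=j_0=0$, $i_{r+1}=j_{r+1}=n+1$. A permutation avoids a pattern if it has no occurrence of it. For $\pi\in\mathfrak S_n$ and an integer $m$, the permutation $\pi\oplus m\in\mathfrak S_n$ is defined as follows: form the circular word $0\,\pi_1\pi_2\cdots\pi_n$ on $\{0,\dots,n\}$, add $m$ modulo $n+1$ to every letter, and read the resulting circular word starting just after the letter $0$. For a pattern $\mathbf p=(p,X,Y)$ of rank $r$ whose letter $r$ is at position $\ell$ in $p$, define $\mathbf p\oplus1=(p\oplus1,\;X\ominus\ell,\;Y\oplus1)$, where $X\ominus\ell=\{x-\ell \bmod (r+1): x\in X\}$ and $Y\oplus 1=\{y+1\bmod (r+1): y\in Y\}$. *)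

theory Defs
  imports "HOL-Combinatorics.Combinatorics"
begin

text \<open>
  Permutations of rank \<open>n\<close> are written in one-line notation, as the words in
  \<^term>\<open>permutations_of_set {1..n::nat}\<close>. Positions and letters are counted from 1.
\<close>

definition letter :: "nat list \<Rightarrow> nat \<Rightarrow> nat" where
  "letter w k = w ! (k - 1)"

type_synonym pattern = "nat list \<times> nat set \<times> nat set"

definition bivincular_pattern :: "nat \<Rightarrow> pattern \<Rightarrow> bool" where
  "bivincular_pattern r = (\<lambda>(p, X, Y).
     p \<in> permutations_of_set {1..r} \<and> X \<subseteq> {0..r} \<and> Y \<subseteq> {0..r})"

text \<open>
  The functions \<open>i\<close> and \<open>j\<close> below list the positions and the values of an occurrence in
  increasing order, with the conventional boundary entries at \<open>0\<close> and \<open>r + 1\<close>; strict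
  monotonicity up to these entries forces \<open>i k\<close> and \<open>j k\<close> into \<open>{1..n}\<close> for \<open>1 \<le> k \<le> r\<close>.
  The values of \<open>i\<close> and \<open>j\<close> outside \<open>{0..r + 1}\<close> play no role.
\<close>

definition occurrence :: "pattern \<Rightarrow> nat list \<Rightarrow> (nat \<Rightarrow> nat) \<Rightarrow> bool" where
  "occurrence = (\<lambda>(p, X, Y) \<pi> i.
     let r = length p; n = length \<pi> in
       i 0 = 0 \<and> i (r + 1) = n + 1 \<and> strict_mono_on {0..r + 1} i \<and>
       (\<forall>a\<in>{1..r}. \<forall>b\<in>{1..r}.
          letter \<pi> (i a) < letter \<pi> (i b) \<longleftrightarrow> letter p a < letter p b) \<and>
       (\<forall>x\<in>X. i (x + 1) = i x + 1) \<and>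
       (\<exists>j. j 0 = 0 \<and> j (r + 1) = n + 1 \<and> strict_mono_on {0..r + 1} j \<and>
          j ` {1..r} = (\<lambda>k. letter \<pi> (i k)) ` {1..r} \<and>
          (\<forall>y\<in>Y. j (y + 1) = j y + 1)))"

definition avoids :: "nat list \<Rightarrow> pattern \<Rightarrow> bool" where
  "avoids \<pi> P \<longleftrightarrow> (\<nexists>i. occurrence P \<pi> i)"

text \<open>
  The word \<open>w\<close> represents the circular word \<open>0 \<pi>\<^sub>1 \<dots> \<pi>\<^sub>n\<close> after adding \<open>m\<close> modulo
  \<open>n + 1\<close>; it is then cut at its letter \<open>0\<close>, which is dropped.
\<close>

definition oplus :: "nat list \<Rightarrow> int \<Rightarrow> nat list" where
  "oplus \<pi> m =
     (let n = length \<pi>;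
          w = map (\<lambda>a. nat ((int a + m) mod (int n + 1))) (0 # \<pi>)
      in tl (dropWhile (\<lambda>a. a \<noteq> 0) w) @ takeWhile (\<lambda>a. a \<noteq> 0) w)"

text \<open>
  The position of the letter \<open>r\<close> is looked up in \<open>0 # p\<close>, where the letter at position
  \<open>k \<ge> 1\<close> of \<open>p\<close> has index \<open>k\<close>. This also covers rank \<open>r = 0\<close>, with position \<open>0\<close>.
\<close>

definition pattern_oplus1 :: "pattern \<Rightarrow> pattern" where
  "pattern_oplus1 = (\<lambda>(p, X, Y).
     let r = length p;
         l = (THE l. l \<le> r \<and> (0 # p) ! l = r)
     in (oplus p 1,
         (\<lambda>x. nat ((int x - int l) mod (int r + 1))) ` X,
         (\<lambda>y. (y + 1) mod (r + 1)) ` Y))"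

end

theory Submission
  imports Defs "HOL-Number_Theory.Cong"
begin

text \<open>
  Extend the positions \<open>i\<close> and the values \<open>j\<close> of an occurrence to increasing functions on the
  integers with \<open>f (k + (r + 1)) = f k + (n + 1)\<close>, and read \<open>0 p\<close> and \<open>0 \<pi>\<close> as periodic words.
  The boundary conventions of bivincular patterns then become instances of periodicity, and
  adding 1 is a mere translation: \<open>i\<close> is replaced by \<open>\<lambda>k. i (k + l) - L\<close> and \<open>j\<close> by
  \<open>\<lambda>y. j (y - 1) + 1\<close>, where \<open>l\<close> and \<open>L\<close> are the positions of the greatest letters. The
  hypothesis \<open>r \<in> Y\<close> says exactly that the greatest letter of \<open>\<pi>\<close> takes part in the occurrence,
  so that this translation preserves the normalisation \<open>i 0 = 0\<close>, \<open>j 0 = 0\<close>.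
\<close>

section \<open>Quasi-periodic functions on the integers\<close>

definition quasi_periodic :: "int \<Rightarrow> int \<Rightarrow> (int \<Rightarrow> int) \<Rightarrow> bool" where
  "quasi_periodic N M f \<longleftrightarrow> strict_mono f \<and> (\<forall>k. f (k + N) = f k + M)"

lemma quasi_periodic_add_mult:
  assumes "quasi_periodic N M f"
  shows "f (k + m * N) = f k + m * M"
proof (induction m rule: int_induct[where k = 0])
  case base
  show ?case by simp
next
  case (step1 m)
  have "f (k + (m + 1) * N) = f (k + m * N) + M"
    using assms by (simp add: quasi_periodic_def distrib_right flip: add.assoc)
  then show ?case
    using step1 by (simp add: distrib_right)
next
  case (step2 m)
  have "f (k + (m - 1) * N + N) = f (k + (m - 1) * N) + M"
    using assms unfolding quasi_periodic_def by blast
  then show ?case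
    using step2 by (simp add: algebra_simps)
qed

lemma quasi_periodic_mod:
  assumes "quasi_periodic N M f"
  shows "f k = f (k mod N) + (k div N) * M"
  using quasi_periodic_add_mult[OF assms, of "k mod N" "k div N"] by simp

text \<open>Adding \<open>m * N\<close> to the argument adds \<open>m * M\<close> to the value, so
  \<open>f\<close> induces a map from residues mod \<open>N\<close> to residues mod
  \<open>M\<close>.\<close>

lemma quasi_periodic_cong:
  assumes "quasi_periodic N M f" "[a = b] (mod N)"
  shows "[f a = f b] (mod M)"
proof -
  have "f a = f (a mod N) + (a div N) * M" "f b = f (a mod N) + (b div N) * M"
    using quasi_periodic_mod[OF assms(1)] assms(2) by (metis cong_def)+
  then show ?thesis
    by (simp add: cong_def)
qed

text \<open>\<open>f (a + 1)\<close> and \<open>f a\<close> move by the same amount when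
  \<open>a\<close> moves by a multiple of \<open>N\<close>. This is why the sets \<open>X\<close>
  and \<open>Y\<close> can be shifted modulo \<open>r + 1\<close>.\<close>

lemma quasi_periodic_step_cong:
  assumes "quasi_periodic N M f" "[a = b] (mod N)"
  shows "f (a + 1) = f a + 1 \<longleftrightarrow> f (b + 1) = f b + 1"
proof -
  obtain m where "b = a + m * N"
    using assms(2) by (metis cong_iff_lin mult.commute)
  then show ?thesis
    using quasi_periodic_add_mult[OF assms(1), of a m]
      quasi_periodic_add_mult[OF assms(1), of "a + 1" m]
    by (simp add: algebra_simps)
qed

text \<open>The translation by \<open>(a, b)\<close> is undone by the one by
  \<open>(- a, - b)\<close>, so one implication gives both.\<close>

lemma quasi_periodic_translate:
  "quasi_periodic N M (\<lambda>k. f (k + a) + b) \<longleftrightarrow> quasi_periodic N M f"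
proof -
  have *: "quasi_periodic N M (\<lambda>k. f (k + a) + b)" if "quasi_periodic N M f" for f a b
    using that by (auto simp: quasi_periodic_def strict_mono_def) (metis add.commute add.left_commute)
  show ?thesis
    using *[of f a b] *[of "\<lambda>k. f (k + a) + b" "-a" "-b"] by auto
qed

lemma strict_mono_int_stepI:
  fixes f :: "int \<Rightarrow> int"
  assumes "\<And>k. f k < f (k + 1)"
  shows "strict_mono f"
proof
  fix a b :: int
  assume "a < b"
  then show "f a < f b"
  proof (induction b rule: int_gr_induct)
    case base
    show ?case by (rule assms)
  next
    case (step b)
    then show ?case using assms[of b] by simp
  qed
qed

text \<open>The values on \<open>{0..r}\<close> determine the extension; \<open>f 0 = 0\<close> and
  \<open>f (r + 1) = n + 1\<close> make it agree with the boundary entry at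
  \<open>r + 1\<close>.\<close>

lemma quasi_periodic_extension:
  fixes f :: "nat \<Rightarrow> nat"
  assumes "f 0 = 0" "f (r + 1) = n + 1" "strict_mono_on {0..r + 1} f"
  obtains g where "quasi_periodic (int r + 1) (int n + 1) g"
    "\<And>k. k \<in> {0..r + 1} \<Longrightarrow> g (int k) = int (f k)"
proof
  define N M where "N = int r + 1" and "M = int n + 1"
  define g where "g k = int (f (nat (k mod N))) + (k div N) * M" for k
  have N: "N > 0" by (simp add: N_def)
  have *: "g (int k) = int (f k)" if "k \<in> {0..r + 1}" for k
  proof (cases "k = r + 1")
    case True
    then have "int k = N" by (simp add: N_def)
    then show ?thesis using True assms N by (simp add: g_def M_def)
  next
    case False
    then have "int k < N" using that by (simp add: N_def)
    then show ?thesis by (simp add: g_def)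
  qed
  then show "\<And>k. k \<in> {0..r + 1} \<Longrightarrow> g (int k) = int (f k)" .
  have per: "g (k + m * N) = g k + m * M" for k m
    using N by (simp add: g_def algebra_simps)
  have "g k < g (k + 1)" for k
  proof -
    define a where "a = nat (k mod N)"
    have a: "a \<le> r" "int a = k mod N"
      using N pos_mod_bound[OF N, of k] by (simp_all add: a_def N_def)
    \<comment> \<open>For \<open>a = r\<close> this compares the last entry with the boundary entry
      \<open>n + 1\<close>, so growth also holds across the end of a period.\<close>
    have "g (int a) < g (int (a + 1))"
      using a(1) strict_mono_onD[OF assms(3), of a "a + 1"] *[of a] *[of "a + 1"] by simp
    then have "g (k mod N) < g (k mod N + 1)"
      using a(2) by (simp add: add.commute)
    moreover have "g k = g (k mod N) + (k div N) * M"
      "g (k + 1) = g (k mod N + 1) + (k div N) * M"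
      using per[of "k mod N" "k div N"] per[of "k mod N + 1" "k div N"]
      by (simp_all add: algebra_simps)
    ultimately show ?thesis by simp
  qed
  then show "quasi_periodic (int r + 1) (int n + 1) g"
    using per[where m = 1] strict_mono_int_stepI unfolding quasi_periodic_def N_def M_def by auto
qed

lemma quasi_periodic_restriction:
  assumes "quasi_periodic (int r + 1) (int n + 1) g" "g 0 = 0"
  obtains f where "\<And>k. int (f k) = g (int k)" "f 0 = 0" "f (r + 1) = n + 1"
    "strict_mono_on {0..r + 1} f"
proof
  \<comment> \<open>Monotonicity and \<open>g 0 = 0\<close> make \<open>g\<close> nonnegative on the
    naturals, so truncation by \<open>nat\<close> loses nothing.\<close>
  define f where "f k = nat (g (int k))" for k
  have mono: "strict_mono g" using assms(1) by (simp add: quasi_periodic_def)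
  show *: "int (f k) = g (int k)" for k
    using strict_mono_less_eq[OF mono, of 0 "int k"] assms(2) by (simp add: f_def)
  show "f 0 = 0" using assms(2) by (simp add: f_def)
  have "g (0 + (int r + 1)) = g 0 + (int n + 1)"
    using assms(1) unfolding quasi_periodic_def by blast
  then show "f (r + 1) = n + 1"
    using assms(2) by (simp add: f_def add.commute)
  show "strict_mono_on {0..r + 1} f"
  proof (rule strict_mono_onI)
    fix a b :: nat assume "a < b"
    then have "g (int a) < g (int b)" using mono by (simp add: strict_mono_less)
    then show "f a < f b" using *[of a] *[of b] by linarith
  qed
qed

section \<open>Permutations as circular words\<close>

definition circular :: "nat list \<Rightarrow> int \<Rightarrow> int" where
  "circular w k = int ((0 # w) ! nat (k mod (int (length w) + 1)))"

lemma circular_cong: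
  "[a = b] (mod (int (length w) + 1)) \<Longrightarrow> circular w a = circular w b"
  by (simp add: circular_def cong_def)

lemma circular_0: "circular w 0 = 0"
  by (simp add: circular_def)

lemma circular_letter:
  assumes "k \<in> {1..length w}"
  shows "circular w (int k) = int (letter w k)"
  using assms by (simp add: circular_def letter_def nth_Cons')

lemma permutations_of_set_length:
  "w \<in> permutations_of_set {1..n::nat} \<Longrightarrow> length w = n"
  by (simp add: length_finite_permutations_of_set)

lemma bij_betw_letter:
  assumes "w \<in> permutations_of_set {1..n}"
  shows "bij_betw (letter w) {1..n} {1..n}"
proof -
  have w: "distinct w" "set w = {1..n}" "length w = n"
    using assms by (auto simp: permutations_of_set_def permutations_of_set_length)
  have "bij_betw ((!) w) {..<n} {1..n}"
    using bij_betw_nth[of w "{..<n}" "{1..n}"] w by simp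
  moreover have "bij_betw (\<lambda>k. k - 1) {1..n} {..<n}"
    by (rule bij_betw_byWitness[where f' = Suc]) auto
  ultimately have "bij_betw ((!) w \<circ> (\<lambda>k. k - 1)) {1..n} {1..n}"
    using bij_betw_trans by blast
  then show ?thesis
    by (simp add: letter_def[abs_def] comp_def)
qed

lemma Cons_0_permutation:
  assumes "w \<in> permutations_of_set {1..n::nat}"
  shows "distinct (0 # w)" "set (0 # w) = {0..n}" "length (0 # w) = n + 1"
  using assms by (auto simp: permutations_of_set_def permutations_of_set_length)

lemma circular_range:
  assumes "w \<in> permutations_of_set {1..n}"
  shows "circular w k \<in> {0..int n}"
proof -
  have "nat (k mod (int n + 1)) < length (0 # w)"
    using Cons_0_permutation(3)[OF assms] pos_mod_bound[of "int n + 1" k] by simp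
  then have "(0 # w) ! nat (k mod (int n + 1)) \<in> {0..n}"
    using Cons_0_permutation(2)[OF assms] nth_mem by metis
  then show ?thesis
    by (simp add: circular_def permutations_of_set_length[OF assms])
qed

lemma circular_inj:
  assumes "w \<in> permutations_of_set {1..n}" "circular w a = circular w b"
  shows "[a = b] (mod (int n + 1))"
proof -
  have "nat (k mod (int n + 1)) < length (0 # w)" for k
    using Cons_0_permutation(3)[OF assms(1)] pos_mod_bound[of "int n + 1" k] by simp
  then have "nat (a mod (int n + 1)) = nat (b mod (int n + 1))"
    using assms(2) Cons_0_permutation(1)[OF assms(1)]
    by (simp add: circular_def permutations_of_set_length[OF assms(1)] nth_eq_iff_index_eq
        del: distinct.simps length_Cons)
  moreover have "a mod (int n + 1) \<ge> 0" "b mod (int n + 1) \<ge> 0"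
    by simp_all
  ultimately show ?thesis
    unfolding cong_def by linarith
qed

text \<open>Searching in \<open>0 # w\<close> covers \<open>n = 0\<close>, where the greatest letter
  is the leading 0 at index 0.\<close>

lemma greatest_letter_position:
  assumes "w \<in> permutations_of_set {1..n}"
  obtains l where "l \<le> n" "(0 # w) ! l = n" "circular w (int l) = int n"
proof -
  have "n \<in> set (0 # w)"
    using Cons_0_permutation(2)[OF assms] by simp
  then obtain l where "l < n + 1" "(0 # w) ! l = n"
    using Cons_0_permutation(3)[OF assms] by (metis in_set_conv_nth)
  then show ?thesis
    using that[of l] by (simp add: circular_def permutations_of_set_length[OF assms])
qed

section \<open>Adding 1 to a circular word\<close>

text \<open>Only the letter \<open>n\<close> becomes 0 when 1 is added modulo \<open>n + 1\<close>,
  so cutting at the new 0 means cutting at index \<open>l\<close>. Keeping the 0 in front turns the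
  cut into a pure rotation.\<close>

lemma oplus1_rotate:
  assumes "w \<in> permutations_of_set {1..n}" "l \<le> n" "(0 # w) ! l = n"
  shows "0 # oplus w 1 = rotate l (map (\<lambda>a. (a + 1) mod (n + 1)) (0 # w))"
proof -
  define v where "v = map (\<lambda>a. (a + 1) mod (n + 1)) (0 # w)"
  have v': "v = map (\<lambda>a. nat ((int a + 1) mod (int n + 1))) (0 # w)"
    by (simp add: v_def nat_mod_as_int add.commute)
  note w = Cons_0_permutation[OF assms(1)]
  have len: "length v = n + 1" using w by (simp add: v_def)
  have vl: "v ! l = 0"
    using assms(2,3) w(3) unfolding v_def by (subst nth_map) simp_all
  \<comment> \<open>Letters are distinct, so those before index \<open>l\<close> differ from
    \<open>n\<close> and do not wrap around to 0.\<close>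
  have nz: "v ! k \<noteq> 0" if "k < l" for k
  proof -
    have k: "k < length (0 # w)" "l < length (0 # w)" using that assms w by auto
    then have "(0 # w) ! k \<noteq> n"
      using that nth_eq_iff_index_eq[OF w(1) k] unfolding assms(3) by blast
    moreover have "(0 # w) ! k \<le> n"
      using w(2) nth_mem[OF k(1)] by (metis atLeastAtMost_iff)
    ultimately show ?thesis
      using k(1) unfolding v_def by (subst nth_map) simp_all
  qed
  have "takeWhile (\<lambda>a. a \<noteq> 0) v = take l v"
    using vl nz len assms(2) by (intro takeWhile_eq_take_P_nth) auto
  moreover from this have "dropWhile (\<lambda>a. a \<noteq> 0) v = drop l v"
    using len assms(2) by (simp add: dropWhile_eq_drop)
  ultimately have "oplus w 1 = tl (drop l v) @ take l v"
    by (simp add: oplus_def permutations_of_set_length[OF assms(1)] Let_def v'[symmetric] del: list.map)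
  moreover have "drop l v = 0 # tl (drop l v)"
    using vl len assms(2) Cons_nth_drop_Suc[of l v] by (metis list.sel(3) Suc_eq_plus1 le_imp_less_Suc)
  ultimately have "0 # oplus w 1 = drop l v @ take l v"
    by (metis append_Cons)
  also have "\<dots> = rotate l v"
    using len assms(2) by (simp add: rotate_drop_take)
  finally show ?thesis unfolding v_def .
qed

text \<open>Adding 1 modulo \<open>n + 1\<close> permutes \<open>{0..n}\<close>, and rotation keeps
  the letters and their distinctness; the leading 0 is then removed.\<close>

lemma oplus1_permutation:
  assumes "w \<in> permutations_of_set {1..n}"
  shows "oplus w 1 \<in> permutations_of_set {1..n}"
proof -
  obtain l where l: "l \<le> n" "(0 # w) ! l = n"
    using greatest_letter_position[OF assms] .
  note w = Cons_0_permutation[OF assms]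
  let ?f = "\<lambda>a. (a + 1) mod (n + 1)"
  have inj: "inj_on ?f {0..n}"
    by (rule inj_onI) (auto simp: mod_Suc split: if_splits)
  have "?f ` {0..n} = {0..n}"
    by (rule endo_inj_surj[OF _ _ inj]) auto
  then have "distinct (0 # oplus w 1)" "set (0 # oplus w 1) = {0..n}"
    using w inj unfolding oplus1_rotate[OF assms l]
    by (simp_all only: distinct_rotate set_rotate distinct_map set_map)
  moreover have "{1..n} = {0..n} - {0}" by auto
  ultimately show ?thesis
    by (auto simp: permutations_of_set_def)
qed

text \<open>The rotation moves the letter at index \<open>k\<close> to index \<open>k - l\<close>.
  Integer indices absorb all wrapping around.\<close>

lemma circular_oplus1:
  assumes "w \<in> permutations_of_set {1..n}" "l \<le> n" "(0 # w) ! l = n"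
  shows "circular (oplus w 1) (k - int l) = (circular w k + 1) mod (int n + 1)"
proof -
  define a where "a = nat ((k - int l) mod (int n + 1))"
  have a: "a < n + 1" "int a = (k - int l) mod (int n + 1)"
    using pos_mod_bound[of "int n + 1" "k - int l"] by (simp_all add: a_def)
  have "int ((l + a) mod (n + 1)) = k mod (int n + 1)"
    using a(2) by (simp add: of_nat_mod mod_simps add.commute)
  then have la: "(l + a) mod (n + 1) = nat (k mod (int n + 1))"
    by linarith
  have len: "length (0 # w) = n + 1" by (rule Cons_0_permutation(3)[OF assms(1)])
  have "circular (oplus w 1) (k - int l) = int ((0 # oplus w 1) ! a)"
    using permutations_of_set_length[OF oplus1_permutation[OF assms(1)]]
    by (simp add: circular_def a_def)
  also have "(0 # oplus w 1) ! a = ((0 # w) ! ((l + a) mod (n + 1)) + 1) mod (n + 1)"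
    unfolding oplus1_rotate[OF assms] using a(1) len
    by (subst nth_rotate) (simp_all del: list.map length_Cons)
  also have "int \<dots> = (circular w k + 1) mod (int n + 1)"
    unfolding la circular_def permutations_of_set_length[OF assms(1)]
    by (simp add: of_nat_mod add.commute)
  finally show ?thesis .
qed

section \<open>Occurrences in circular form\<close>

text \<open>Order isomorphism is encoded by a formula: the letter of \<open>\<pi>\<close> at the
  \<open>k\<close>-th chosen position is the value that \<open>j\<close> assigns to the
  \<open>k\<close>-th letter of \<open>p\<close>. It is a congruence, and \<open>i 0\<close> and
  \<open>j 0\<close> are left free, so that the notion can be translated.\<close>

definition circular_occurrence ::
  "pattern \<Rightarrow> nat list \<Rightarrow> (int \<Rightarrow> int) \<Rightarrow> (int \<Rightarrow> int) \<Rightarrow> bool" where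
  "circular_occurrence = (\<lambda>(p, X, Y) \<pi> i j.
     quasi_periodic (int (length p) + 1) (int (length \<pi>) + 1) i \<and>
     quasi_periodic (int (length p) + 1) (int (length \<pi>) + 1) j \<and>
     (\<forall>k. [circular \<pi> (i k) = j (circular p k)] (mod (int (length \<pi>) + 1))) \<and>
     (\<forall>x\<in>X. i (int x + 1) = i (int x) + 1) \<and>
     (\<forall>y\<in>Y. j (int y + 1) = j (int y) + 1))"

text \<open>A finite set has only one strictly increasing listing, and both functions list the same
  set.\<close>

lemma strict_mono_on_eq_of_image_eq:
  fixes f g :: "nat \<Rightarrow> 'a::linorder"
  assumes "strict_mono_on {1..r} f" "strict_mono_on {1..r} g" "f ` {1..r} = g ` {1..r}"
    and "k \<in> {1..r}"
  shows "f k = g k"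
proof -
  have *: "sorted_wrt (<) (map h [1..<r + 1])" if "strict_mono_on {1..r} h" for h :: "nat \<Rightarrow> 'a"
    using that unfolding sorted_wrt_map
    by (intro sorted_wrt_mono_rel[OF _ sorted_wrt_upt]) (auto simp: strict_mono_on_def)
  have "map f [1..<r + 1] = map g [1..<r + 1]"
    using *[OF assms(1)] *[OF assms(2)] assms(3)
    by (intro strict_sorted_equal) (simp_all add: atLeastLessThanSuc_atLeastAtMost del: upt_Suc)
  then show ?thesis
    using assms(4) by (simp del: upt_Suc)
qed

text \<open>Reading the values \<open>f\<close> in the order of the letters of \<open>p\<close>
  sorts them, and \<open>j\<close> lists the same values in increasing order.\<close>

lemma occurrence_values:
  assumes p: "p \<in> permutations_of_set {1..r}"
    and ord: "\<forall>a\<in>{1..r}. \<forall>b\<in>{1..r}. f a < f b \<longleftrightarrow> letter p a < letter p b"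
    and j: "strict_mono_on {1..r} (j :: nat \<Rightarrow> nat)" "j ` {1..r} = f ` {1..r}"
    and k: "k \<in> {1..r}"
  shows "f k = j (letter p k)"
proof -
  note bij = bij_betw_letter[OF p]
  \<comment> \<open>\<open>q v\<close> is the position of the letter \<open>v\<close> in
    \<open>p\<close>.\<close>
  define q where "q = inv_into {1..r} (letter p)"
  have q: "q v \<in> {1..r}" "letter p (q v) = v" if "v \<in> {1..r}" for v
    using that bij unfolding q_def
    by (metis bij_betw_imp_surj_on inv_into_into, metis bij_betw_inv_into_right)
  have qp: "q (letter p a) = a" "letter p a \<in> {1..r}" if "a \<in> {1..r}" for a
    using that bij unfolding q_def
    by (metis bij_betw_inv_into_left, metis bij_betwE)
  have "strict_mono_on {1..r} (f \<circ> q)"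
    using ord q by (auto intro!: strict_mono_onI simp: comp_def)
  moreover have "q ` {1..r} = {1..r}"
    using bij_betw_inv_into[OF bij] by (simp add: bij_betw_def q_def)
  then have "(f \<circ> q) ` {1..r} = j ` {1..r}"
    using j(2) by (simp only: image_comp[symmetric])
  ultimately have "(f \<circ> q) (letter p k) = j (letter p k)"
    using strict_mono_on_eq_of_image_eq[OF _ j(1)] qp(2)[OF k] by blast
  then show ?thesis
    using qp(1)[OF k] by simp
qed

lemma occurrence_imp_circular:
  assumes pat: "bivincular_pattern r (p, X, Y)" and \<pi>: "\<pi> \<in> permutations_of_set {1..n}"
    and occ: "occurrence (p, X, Y) \<pi> i"
  obtains I J where "circular_occurrence (p, X, Y) \<pi> I J" "I 0 = 0" "J 0 = 0"
proof -
  have p: "p \<in> permutations_of_set {1..r}" and XY: "X \<subseteq> {0..r}" "Y \<subseteq> {0..r}"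
    using pat by (auto simp: bivincular_pattern_def)
  note len = permutations_of_set_length[OF p] permutations_of_set_length[OF \<pi>]
  obtain j where i: "i 0 = 0" "i (r + 1) = n + 1" "strict_mono_on {0..r + 1} i"
    and ord: "\<forall>a\<in>{1..r}. \<forall>b\<in>{1..r}.
      letter \<pi> (i a) < letter \<pi> (i b) \<longleftrightarrow> letter p a < letter p b"
    and X: "\<forall>x\<in>X. i (x + 1) = i x + 1"
    and j: "j 0 = 0" "j (r + 1) = n + 1" "strict_mono_on {0..r + 1} j"
    and im: "j ` {1..r} = (\<lambda>k. letter \<pi> (i k)) ` {1..r}"
    and Y: "\<forall>y\<in>Y. j (y + 1) = j y + 1"
    using occ unfolding occurrence_def Let_def prod.case len by blast
  obtain I where I: "quasi_periodic (int r + 1) (int n + 1) I"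
    "\<And>k. k \<in> {0..r + 1} \<Longrightarrow> I (int k) = int (i k)"
    using quasi_periodic_extension[OF i] by blast
  obtain J where J: "quasi_periodic (int r + 1) (int n + 1) J"
    "\<And>k. k \<in> {0..r + 1} \<Longrightarrow> J (int k) = int (j k)"
    using quasi_periodic_extension[OF j] by blast
  have j': "strict_mono_on {1..r} j"
    using j(3) by (rule monotone_on_subset) auto
  \<comment> \<open>Index 0 compares the two leading zeros; the other indices of this period carry
    genuine letters.\<close>
  have val: "circular \<pi> (I (int k)) = J (circular p (int k))" if "k \<le> r" for k
  proof (cases "k = 0")
    case True
    then show ?thesis
      using I(2)[of 0] J(2)[of 0] i(1) j(1) by (simp add: circular_0)
  next
    case False
    then have k: "k \<in> {1..r}" using that by simp
    have "i 0 < i k" "i k < i (r + 1)"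
      using i(3) k by (auto intro!: strict_mono_onD[OF i(3)])
    then have ik: "i k \<in> {1..n}" using i by simp
    have pk: "letter p k \<in> {1..r}"
      using bij_betwE[OF bij_betw_letter[OF p]] k by blast
    have "circular \<pi> (I (int k)) = int (letter \<pi> (i k))"
      using I(2)[of k] k ik len by (simp add: circular_letter)
    also have "letter \<pi> (i k) = j (letter p k)"
      by (rule occurrence_values[OF p ord j' im k])
    also have "int (j (letter p k)) = J (circular p (int k))"
      using J(2)[of "letter p k"] k pk len by (simp add: circular_letter)
    finally show ?thesis .
  qed
  \<comment> \<open>Both sides depend only on \<open>k\<close> modulo \<open>r + 1\<close>, so one
    period suffices.\<close>
  have "[circular \<pi> (I k) = J (circular p k)] (mod (int n + 1))" for k
  proof -
    define a where "a = nat (k mod (int r + 1))"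
    have a: "a \<le> r" "int a = k mod (int r + 1)"
      using pos_mod_bound[of "int r + 1" k] by (simp_all add: a_def)
    have ka: "[k = int a] (mod (int r + 1))" by (simp add: a(2) cong_def)
    have "circular \<pi> (I k) = circular \<pi> (I (int a))"
      using quasi_periodic_cong[OF I(1) ka] len by (simp add: circular_cong)
    moreover have "circular p k = circular p (int a)"
      using ka len by (simp add: circular_cong)
    ultimately show ?thesis
      using val[OF a(1)] by simp
  qed
  \<comment> \<open>As \<open>x \<le> r\<close>, both \<open>x\<close> and \<open>x + 1\<close> lie
    in \<open>{0..r + 1}\<close>, where \<open>I\<close> agrees with \<open>i\<close>.\<close>
  moreover have "\<forall>x\<in>X. I (int x + 1) = I (int x) + 1"
  proof
    fix x assume "x \<in> X"
    then show "I (int x + 1) = I (int x) + 1"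
      using X XY I(2)[of x] I(2)[of "x + 1"] by (auto simp: add.commute)
  qed
  moreover have "\<forall>y\<in>Y. J (int y + 1) = J (int y) + 1"
  proof
    fix y assume "y \<in> Y"
    then show "J (int y + 1) = J (int y) + 1"
      using Y XY J(2)[of y] J(2)[of "y + 1"] by (auto simp: add.commute)
  qed
  ultimately have "circular_occurrence (p, X, Y) \<pi> I J"
    using I(1) J(1) by (simp add: circular_occurrence_def len)
  moreover have "I 0 = 0" "J 0 = 0"
    using I(2)[of 0] J(2)[of 0] i(1) j(1) by simp_all
  ultimately show ?thesis by (rule that)
qed

lemma circular_imp_occurrence:
  assumes pat: "bivincular_pattern r (p, X, Y)" and \<pi>: "\<pi> \<in> permutations_of_set {1..n}"
    and occ: "circular_occurrence (p, X, Y) \<pi> I J" and IJ: "I 0 = 0" "J 0 = 0"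
  obtains i where "occurrence (p, X, Y) \<pi> i"
proof -
  have p: "p \<in> permutations_of_set {1..r}"
    using pat by (auto simp: bivincular_pattern_def)
  note len = permutations_of_set_length[OF p] permutations_of_set_length[OF \<pi>]
  have qI: "quasi_periodic (int r + 1) (int n + 1) I"
    and qJ: "quasi_periodic (int r + 1) (int n + 1) J"
    and val: "\<And>k. [circular \<pi> (I k) = J (circular p k)] (mod (int n + 1))"
    and X: "\<And>x. x \<in> X \<Longrightarrow> I (int x + 1) = I (int x) + 1"
    and Y: "\<And>y. y \<in> Y \<Longrightarrow> J (int y + 1) = J (int y) + 1"
    using occ by (simp_all add: circular_occurrence_def len)
  obtain i where i: "\<And>k. int (i k) = I (int k)" "i 0 = 0" "i (r + 1) = n + 1"
    "strict_mono_on {0..r + 1} i"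
    using quasi_periodic_restriction[OF qI IJ(1)] by blast
  obtain j where j: "\<And>k. int (j k) = J (int k)" "j 0 = 0" "j (r + 1) = n + 1"
    "strict_mono_on {0..r + 1} j"
    using quasi_periodic_restriction[OF qJ IJ(2)] by blast
  note bij = bij_betw_letter[OF p]
  have letters: "letter \<pi> (i k) = j (letter p k)" if k: "k \<in> {1..r}" for k
  proof -
    have "i 0 < i k" "i k < i (r + 1)"
      using k by (auto intro!: strict_mono_onD[OF i(4)])
    then have ik: "i k \<in> {1..n}" using i by simp
    have pk: "letter p k \<in> {1..r}"
      using bij_betwE[OF bij] k by blast
    \<comment> \<open>Bounding both sides below \<open>n + 1\<close> turns the congruence into an
      equality.\<close>
    have "j (letter p k) < j (r + 1)"
      using pk by (auto intro!: strict_mono_onD[OF j(4)])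
    then have "j (letter p k) < n + 1" using j by simp
    moreover have "letter \<pi> (i k) < n + 1"
      using bij_betwE[OF bij_betw_letter[OF \<pi>]] ik by fastforce
    moreover have "[int (letter \<pi> (i k)) = int (j (letter p k))] (mod (int n + 1))"
      using val[of "int k"] k ik len by (simp add: circular_letter i(1)[symmetric] j(1))
    ultimately show ?thesis
      by (simp add: cong_def)
  qed
  \<comment> \<open>By \<open>letters\<close>, the increasing function \<open>j\<close> carries the
    order of the letters of \<open>p\<close> over to those of \<open>\<pi>\<close>.\<close>
  have "letter \<pi> (i a) < letter \<pi> (i b) \<longleftrightarrow> letter p a < letter p b"
    if "a \<in> {1..r}" "b \<in> {1..r}" for a b
  proof -
    have "letter p a \<in> {0..r + 1}" "letter p b \<in> {0..r + 1}"
      using bij_betwE[OF bij] that by fastforce+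
    then show ?thesis
      using letters that strict_mono_on_less[OF j(4)] by simp
  qed
  moreover have "j ` {1..r} = (\<lambda>k. letter \<pi> (i k)) ` {1..r}"
  proof -
    have "j ` {1..r} = j ` letter p ` {1..r}"
      using bij by (simp add: bij_betw_def)
    also have "\<dots> = (\<lambda>k. letter \<pi> (i k)) ` {1..r}"
      unfolding image_image using letters by (intro image_cong) auto
    finally show ?thesis .
  qed
  moreover have "i (x + 1) = i x + 1" if "x \<in> X" for x
    using X[OF that] i(1)[of x] i(1)[of "x + 1"] by (simp add: add.commute)
  moreover have "j (y + 1) = j y + 1" if "y \<in> Y" for y
    using Y[OF that] j(1)[of y] j(1)[of "y + 1"] by (simp add: add.commute)
  ultimately have "occurrence (p, X, Y) \<pi> i"
    using i(2-4) j(2-4) unfolding occurrence_def Let_def prod.case len by blast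
  then show ?thesis by (rule that)
qed

lemma avoids_iff_circular:
  assumes "bivincular_pattern r (p, X, Y)" "\<pi> \<in> permutations_of_set {1..n}"
  shows "avoids \<pi> (p, X, Y) \<longleftrightarrow>
    (\<nexists>I J. circular_occurrence (p, X, Y) \<pi> I J \<and> I 0 = 0 \<and> J 0 = 0)"
  using occurrence_imp_circular[OF assms] circular_imp_occurrence[OF assms]
  unfolding avoids_def by metis

section \<open>Shifting a pattern together with its circular occurrences\<close>

lemma pattern_oplus1_eq:
  assumes p: "p \<in> permutations_of_set {1..r}" and l: "l \<le> r" "(0 # p) ! l = r"
  shows "pattern_oplus1 (p, X, Y) =
    (oplus p 1, (\<lambda>x. nat ((int x - int l) mod (int r + 1))) ` X, (\<lambda>y. (y + 1) mod (r + 1)) ` Y)"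
proof -
  have "(THE l. l \<le> r \<and> (0 # p) ! l = r) = l"
  proof (rule the_equality)
    fix l' assume "l' \<le> r \<and> (0 # p) ! l' = r"
    then show "l' = l"
      using l Cons_0_permutation(1,3)[OF p] nth_eq_iff_index_eq[of "0 # p" l' l] by simp
  qed (use l in simp)
  then show ?thesis
    by (simp add: pattern_oplus1_def permutations_of_set_length[OF p])
qed

lemma bivincular_pattern_oplus1:
  assumes "bivincular_pattern r (p, X, Y)"
  shows "bivincular_pattern r (pattern_oplus1 (p, X, Y))"
proof -
  have p: "p \<in> permutations_of_set {1..r}"
    using assms by (simp add: bivincular_pattern_def)
  obtain l where l: "l \<le> r" "(0 # p) ! l = r"
    using greatest_letter_position[OF p] .
  have "nat (k mod (int r + 1)) \<le> r" for k
    using pos_mod_bound[of "int r + 1" k] by simp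
  then show ?thesis
    using oplus1_permutation[OF p]
    unfolding pattern_oplus1_eq[OF p l] bivincular_pattern_def
    by (auto simp flip: less_Suc_eq_le)
qed

text \<open>Each condition on the translated pair is the corresponding condition on \<open>I\<close>
  and \<open>J\<close>, read at a shifted index. The values at 0 are treated separately in the
  theorem.\<close>

lemma circular_occurrence_oplus1:
  assumes p: "p \<in> permutations_of_set {1..r}" and l: "l \<le> r" "(0 # p) ! l = r"
    and \<pi>: "\<pi> \<in> permutations_of_set {1..n}" and L: "L \<le> n" "(0 # \<pi>) ! L = n"
  shows "circular_occurrence (pattern_oplus1 (p, X, Y)) (oplus \<pi> 1)
      (\<lambda>k. I (k + int l) - int L) (\<lambda>y. J (y - 1) + 1) \<longleftrightarrow>
    circular_occurrence (p, X, Y) \<pi> I J"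
proof -
  note len = permutations_of_set_length[OF p] permutations_of_set_length[OF \<pi>]
    permutations_of_set_length[OF oplus1_permutation[OF p]]
    permutations_of_set_length[OF oplus1_permutation[OF \<pi>]]
  define N M where "N = int r + 1" and "M = int n + 1"
  let ?I = "\<lambda>k. I (k + int l) - int L" and ?J = "\<lambda>y. J (y - 1) + 1"
  have qI: "quasi_periodic N M ?I \<longleftrightarrow> quasi_periodic N M I"
    using quasi_periodic_translate[of N M I "int l" "- int L"] by simp
  have qJ: "quasi_periodic N M ?J \<longleftrightarrow> quasi_periodic N M J"
    using quasi_periodic_translate[of N M J "- 1" 1] by simp
  \<comment> \<open>Periodicity lets \<open>x - l\<close> replace its residue, and there
    \<open>?I\<close> takes the value \<open>I x - L\<close>.\<close>
  have X: "(\<forall>x\<in>(\<lambda>x. nat ((int x - int l) mod (int r + 1))) ` X. ?I (int x + 1) = ?I (int x) + 1) \<longleftrightarrow>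
      (\<forall>x\<in>X. I (int x + 1) = I (int x) + 1)" if q: "quasi_periodic N M I"
  proof -
    have "?I (int (nat ((int x - int l) mod (int r + 1))) + 1)
        = ?I (int (nat ((int x - int l) mod (int r + 1)))) + 1 \<longleftrightarrow>
      I (int x + 1) = I (int x) + 1" for x
      using quasi_periodic_step_cong[OF qI[THEN iffD2, OF q],
          of "(int x - int l) mod N" "int x - int l"]
      by (simp add: N_def algebra_simps)
    then show ?thesis by (simp only: ball_simps)
  qed
  \<comment> \<open>Likewise \<open>y + 1\<close> replaces its residue, and
    \<open>?J (y + 1) = J y + 1\<close>.\<close>
  have Y: "(\<forall>y\<in>(\<lambda>y. (y + 1) mod (r + 1)) ` Y. ?J (int y + 1) = ?J (int y) + 1) \<longleftrightarrow>
      (\<forall>y\<in>Y. J (int y + 1) = J (int y) + 1)" if q: "quasi_periodic N M J"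
  proof -
    have "?J (int ((y + 1) mod (r + 1)) + 1) = ?J (int ((y + 1) mod (r + 1))) + 1 \<longleftrightarrow>
      J (int y + 1) = J (int y) + 1" for y
      using quasi_periodic_step_cong[OF qJ[THEN iffD2, OF q],
          of "(int y + 1) mod N" "int y + 1"]
      by (simp add: N_def of_nat_mod algebra_simps)
    then show ?thesis by (simp only: ball_simps)
  qed
  have val: "(\<forall>k. [circular (oplus \<pi> 1) (?I k) = ?J (circular (oplus p 1) k)] (mod M)) \<longleftrightarrow>
      (\<forall>k. [circular \<pi> (I k) = J (circular p k)] (mod M))" if q: "quasi_periodic N M J"
  proof -
    \<comment> \<open>Index \<open>k - l\<close> of the shifted \<open>p\<close> and index
      \<open>I k - L\<close> of the shifted \<open>\<pi>\<close> show the old letters plus 1 (modulo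
      the period), and \<open>?J\<close> sends an old letter plus 1 to its old value plus 1. So both
      sides of the congruence grow by 1.\<close>
    have *: "[circular (oplus \<pi> 1) (?I (k - int l)) = ?J (circular (oplus p 1) (k - int l))] (mod M)
      \<longleftrightarrow> [circular \<pi> (I k) = J (circular p k)] (mod M)" for k
    proof -
      have "circular (oplus \<pi> 1) (?I (k - int l)) = (circular \<pi> (I k) + 1) mod M"
        using circular_oplus1[OF \<pi> L, of "I k"] by (simp add: M_def)
      then have 1: "[circular (oplus \<pi> 1) (?I (k - int l)) = circular \<pi> (I k) + 1] (mod M)"
        by (simp add: cong_def)
      have "[?J (circular (oplus p 1) (k - int l)) = ?J (circular p k + 1)] (mod M)"
        using circular_oplus1[OF p l, of k]
        by (intro quasi_periodic_cong[OF qJ[THEN iffD2, OF q]]) (simp add: N_def)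
      then have 2: "[?J (circular (oplus p 1) (k - int l)) = J (circular p k) + 1] (mod M)"
        by simp
      have "[circular (oplus \<pi> 1) (?I (k - int l)) = ?J (circular (oplus p 1) (k - int l))] (mod M)
        \<longleftrightarrow> [circular \<pi> (I k) + 1 = J (circular p k) + 1] (mod M)"
        using 1 2 by (simp only: cong_def)
      then show ?thesis
        by (simp only: cong_add_rcancel)
    qed
    show ?thesis
    proof (intro iffI allI)
      fix k
      assume "\<forall>k. [circular (oplus \<pi> 1) (?I k) = ?J (circular (oplus p 1) k)] (mod M)"
      then show "[circular \<pi> (I k) = J (circular p k)] (mod M)"
        using *[of k] by blast
    next
      fix k
      assume "\<forall>k. [circular \<pi> (I k) = J (circular p k)] (mod M)"
      then show "[circular (oplus \<pi> 1) (?I k) = ?J (circular (oplus p 1) k)] (mod M)"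
        using *[of "k + int l"] by simp
    qed
  qed
  have "circular_occurrence (pattern_oplus1 (p, X, Y)) (oplus \<pi> 1) ?I ?J \<longleftrightarrow>
      quasi_periodic N M ?I \<and> quasi_periodic N M ?J \<and>
      (\<forall>k. [circular (oplus \<pi> 1) (?I k) = ?J (circular (oplus p 1) k)] (mod M)) \<and>
      (\<forall>x\<in>(\<lambda>x. nat ((int x - int l) mod (int r + 1))) ` X. ?I (int x + 1) = ?I (int x) + 1) \<and>
      (\<forall>y\<in>(\<lambda>y. (y + 1) mod (r + 1)) ` Y. ?J (int y + 1) = ?J (int y) + 1)"
    unfolding pattern_oplus1_eq[OF p l] circular_occurrence_def prod.case len N_def M_def ..
  also have "\<dots> \<longleftrightarrow> circular_occurrence (p, X, Y) \<pi> I J"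
  \<comment> \<open>The equivalences \<open>X\<close>, \<open>Y\<close> and \<open>val\<close>
    presuppose quasi-periodicity; where it fails, both sides are false.\<close>
  proof (cases "quasi_periodic N M I \<and> quasi_periodic N M J")
    case True
    then show ?thesis
      unfolding qI qJ X[OF conjunct1[OF True]] Y[OF conjunct2[OF True]] val[OF conjunct2[OF True]]
      unfolding circular_occurrence_def prod.case len N_def M_def by (intro refl)
  next
    case False
    then show ?thesis
      unfolding qI qJ unfolding circular_occurrence_def prod.case len N_def M_def by blast
  qed
  finally show ?thesis .
qed

section \<open>Normalisation at 0 and the equivalence\<close>

lemma cong_imp_eq_int:
  fixes a b m :: int
  assumes "[a = b] (mod m)" "\<bar>a - b\<bar> < m"
  shows "a = b"
  using assms dvd_imp_le_int[of "a - b" m] by (auto simp: cong_iff_dvd_diff)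

theorem proposition6p7:
  fixes r n :: nat and p \<pi> :: "nat list" and X Y :: "nat set"
  assumes "bivincular_pattern r (p, X, Y)"
    and "r \<in> Y"
    and "\<pi> \<in> permutations_of_set {1..n}"
  shows "avoids \<pi> (p, X, Y) \<longleftrightarrow> avoids (oplus \<pi> 1) (pattern_oplus1 (p, X, Y))"
proof -
  define N M where "N = int r + 1" and "M = int n + 1"
  have p: "p \<in> permutations_of_set {1..r}"
    using assms(1) by (simp add: bivincular_pattern_def)
  obtain l where l: "l \<le> r" "(0 # p) ! l = r" and cl: "circular p (int l) = int r"
    using greatest_letter_position[OF p] .
  obtain L where L: "L \<le> n" "(0 # \<pi>) ! L = n" and cL: "circular \<pi> (int L) = int n"
    using greatest_letter_position[OF assms(3)] .
  note \<pi>' = oplus1_permutation[OF assms(3)]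
  note p' = oplus1_permutation[OF p]
  note len = permutations_of_set_length[OF p] permutations_of_set_length[OF assms(3)]
    permutations_of_set_length[OF p'] permutations_of_set_length[OF \<pi>']
  note shift = circular_occurrence_oplus1[OF p l assms(3) L, of X Y]
  \<comment> \<open>These two equations say that the translated pair vanishes at 0.\<close>
  have fwd: "I (int l) = int L" "J (- 1) = - 1"
    if occ: "circular_occurrence (p, X, Y) \<pi> I J" and IJ: "I 0 = 0" "J 0 = 0" for I J
  proof -
    have q: "quasi_periodic N M I" "quasi_periodic N M J"
      and val: "[circular \<pi> (I (int l)) = J (circular p (int l))] (mod M)"
      and Jr: "J (int r + 1) = J (int r) + 1"
      using occ assms(2) by (simp_all add: circular_occurrence_def len N_def M_def)
    have JN: "J (k + N) = J k + M" "I (k + N) = I k + M" for k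
      using q by (simp_all add: quasi_periodic_def)
    \<comment> \<open>\<open>J (r + 1)\<close> is \<open>n + 1\<close> by periodicity, and one more
      than \<open>J r\<close> because \<open>r \<in> Y\<close>.\<close>
    have Jr': "J (int r) = int n"
      using Jr JN(1)[of 0] IJ by (simp add: N_def M_def)
    then show "J (- 1) = - 1"
      using JN(1)[of "-1"] by (simp add: N_def M_def)
    have "circular \<pi> (I (int l)) = int n"
      using val circular_range[OF assms(3), of "I (int l)"]
      by (intro cong_imp_eq_int[of _ _ M]) (auto simp: cl Jr' M_def)
    then have "[I (int l) = int L] (mod M)"
      using circular_inj[OF assms(3)] cL by (simp add: M_def)
    moreover have mono: "strict_mono I" using q by (simp add: quasi_periodic_def)
    \<comment> \<open>\<open>0 \<le> l < N\<close> confines \<open>I l\<close> to one period, in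
      which \<open>L\<close> is the only member of its residue class.\<close>
    have "0 \<le> I (int l)" "I (int l) < M"
      using strict_mono_less_eq[OF mono, of 0 "int l"] strict_mono_less[OF mono, of "int l" N]
        JN(2)[of 0] IJ l(1) by (simp_all add: N_def)
    ultimately show "I (int l) = int L"
      using L(1) by (intro cong_imp_eq_int[of _ _ M]) (auto simp: M_def)
  qed
  \<comment> \<open>The element \<open>r\<close> of \<open>Y\<close> has become 0 in the shifted
    set, so now the value 1 is forced into the occurrence.\<close>
  have bwd: "I (- int l) = - int L" "J 1 = 1"
    if occ: "circular_occurrence (pattern_oplus1 (p, X, Y)) (oplus \<pi> 1) I J"
      and IJ: "I 0 = 0" "J 0 = 0" for I J
  proof -
    have "0 \<in> (\<lambda>y. (y + 1) mod (r + 1)) ` Y"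
      using assms(2) by (auto intro!: image_eqI[of _ _ r])
    then have q: "quasi_periodic N M I" "quasi_periodic N M J"
      and val: "[circular (oplus \<pi> 1) (I (- int l)) = J (circular (oplus p 1) (- int l))] (mod M)"
      and J1: "J 1 = J 0 + 1"
      using occ unfolding pattern_oplus1_eq[OF p l] circular_occurrence_def prod.case len N_def M_def
      by force+
    then show J1': "J 1 = 1" using IJ by simp
    \<comment> \<open>Index \<open>- l\<close> is where the leading 0 of \<open>0 # p\<close> lands,
      raised to 1. A congruence is used because for \<open>r = 0\<close> this letter is
      \<open>1 mod 1 = 0\<close>.\<close>
    have "[J (circular (oplus p 1) (- int l)) = J 1] (mod M)"
      using circular_oplus1[OF p l, of 0]
      by (intro quasi_periodic_cong[OF q(2)]) (simp add: circular_0 N_def)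
    \<comment> \<open>\<open>I (- l) + L\<close> is the index in \<open>\<pi>\<close> that the shift
      moves to \<open>I (- l)\<close>; its letter turns out to be the leading 0.\<close>
    moreover have "circular (oplus \<pi> 1) (I (- int l)) = (circular \<pi> (I (- int l) + int L) + 1) mod M"
      using circular_oplus1[OF assms(3) L, of "I (- int l) + int L"] by (simp add: M_def)
    ultimately have "[circular \<pi> (I (- int l) + int L) + 1 = 0 + 1] (mod M)"
      using val J1' by (simp add: cong_def)
    then have "[circular \<pi> (I (- int l) + int L) = 0] (mod M)"
      by (simp only: cong_add_rcancel)
    then have "circular \<pi> (I (- int l) + int L) = 0"
      using circular_range[OF assms(3), of "I (- int l) + int L"]
      by (intro cong_imp_eq_int[of _ _ M]) (auto simp: M_def)
    then have "[I (- int l) + int L = 0] (mod M)"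
      using circular_inj[OF assms(3), of _ 0] by (simp add: circular_0 M_def)
    moreover have mono: "strict_mono I" using q by (simp add: quasi_periodic_def)
    \<comment> \<open>From \<open>- N < - l \<le> 0\<close> follows
      \<open>- M < I (- l) \<le> 0\<close>, so \<open>I (- l) + L\<close> has absolute value below
      \<open>M\<close>.\<close>
    have "I (- N + N) = I (- N) + M"
      using q(1) unfolding quasi_periodic_def by blast
    then have "I (- int l) \<le> 0" "- M < I (- int l)"
      using strict_mono_less_eq[OF mono, of "- int l" 0] strict_mono_less[OF mono, of "- N" "- int l"]
        IJ l(1) by (simp_all add: N_def)
    ultimately have "I (- int l) + int L = 0"
      using L(1) by (intro cong_imp_eq_int[of _ _ M]) (auto simp: M_def)
    then show "I (- int l) = - int L" by simp
  qed
  \<comment> \<open>The witnesses are the translation and its inverse; \<open>fwd\<close> and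
    \<open>bwd\<close> supply their vanishing at 0.\<close>
  have "(\<exists>I J. circular_occurrence (p, X, Y) \<pi> I J \<and> I 0 = 0 \<and> J 0 = 0) \<longleftrightarrow>
    (\<exists>I J. circular_occurrence (pattern_oplus1 (p, X, Y)) (oplus \<pi> 1) I J \<and> I 0 = 0 \<and> J 0 = 0)"
  proof (intro iffI; elim exE conjE)
    fix I J assume "circular_occurrence (p, X, Y) \<pi> I J" "I 0 = 0" "J 0 = 0"
    then show "\<exists>I J. circular_occurrence (pattern_oplus1 (p, X, Y)) (oplus \<pi> 1) I J \<and> I 0 = 0 \<and> J 0 = 0"
      using shift[of I J] fwd[of I J]
      by (intro exI[of _ "\<lambda>k. I (k + int l) - int L"] exI[of _ "\<lambda>y. J (y - 1) + 1"]) simp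
  next
    fix I J
    assume "circular_occurrence (pattern_oplus1 (p, X, Y)) (oplus \<pi> 1) I J" "I 0 = 0" "J 0 = 0"
    then show "\<exists>I J. circular_occurrence (p, X, Y) \<pi> I J \<and> I 0 = 0 \<and> J 0 = 0"
      using shift[of "\<lambda>k. I (k - int l) + int L" "\<lambda>y. J (y + 1) - 1"] bwd[of I J]
      by (intro exI[of _ "\<lambda>k. I (k - int l) + int L"] exI[of _ "\<lambda>y. J (y + 1) - 1"]) simp
  qed
  moreover obtain p1 X1 Y1 where P1: "pattern_oplus1 (p, X, Y) = (p1, X1, Y1)"
    by (metis prod_cases3)
  have "bivincular_pattern r (p1, X1, Y1)"
    using bivincular_pattern_oplus1[OF assms(1)] by (simp add: P1)
  ultimately show ?thesis
    unfolding P1 using avoids_iff_circular[OF assms(1,3)] avoids_iff_circular[OF _ \<pi>'] by simp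
qed

end
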